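(* Let $k,m,n$ be positive integers with $m\le n$, let $\mathbf B\in\mathbb R^{n\times k}$ and $\mathbb b=\mathrm{vec}(\mathbf B)$. Suppose that $\mathbf B$ satisfies the RIP over $\mathcal H$ with parameter $\epsilon\in(0,1)$ and the R-RIP over $\mathcal H-\mathcal H$ with parameter $\delta\in(0,\tfrac12)$ and precision $\mu>0$, where $\epsilon\le\delta$. Let $\check{\mathbf H}=\check{\mathbf y}^{T}\otimes\check{\mathbf S}\in\mathcal H$ with $\check{\mathbf y}\neq 0$, let $\mathbf w\in\mathbb R^m$ be a nonzero noise vector, let $\check{\mathbf x}=\check{\mathbf H}\mathbb b+\mathbf w$, and let $\mathsf{snr}=\|\check{\mathbf H}\mathbb b\|^2/\|\mathbf w\|^2$. Let $$\widehat{\mathbf H}\in\operatorname*{arg\,min}_{\mathbf H\in\mathcal H}\|\mathbf H\mathbb b-\check{\mathbf x}\|.$$ Then $\|\widehat{\mathbf H}-\check{\mathbf H}\|_F\le\chi\,\|\check{\mathbf H}\|_F$, where $$\chi=\max\Big\{\mu\,\frac{\sqrt{1+\epsilon}}{\sqrt{1-\epsilon}}\Big(1+\frac{2}{\sqrt{\mathsf{snr}}}\Big),\ \frac{2}{\sqrt{\mathsf{snr}\,(1-2\delta)}}\Big\}.$$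
   Context: $\mathcal S$ is the set of ordered selection matrices: $m\times n$ matrices $\mathbf S$ with entries in $\{0,1\}$ for which there are indices $1\le i_1<\dots<i_m\le n$ with $\mathbf S_{l,p}=1$ if $p=i_l$ and $\mathbf S_{l,p}=0$ otherwise. $\mathcal H=\{\mathbf y^{T}\otimes\mathbf S:\mathbf y\in\mathbb R^k,\mathbf S\in\mathcal S\}$ (Kronecker product, so elements are $m\times nk$ matrices). $\mathrm{vec}$ stacks columns, so $(\mathbf y^T\otimes\mathbf S)\mathbb b=\mathbf S\mathbf B\mathbf y$. $\|\cdot\|$ is the Euclidean norm, $\|\cdot\|_F$ the Frobenius norm. RIP over $\mathcal H$ with parameter $\epsilon\in(0,1)$: $(1-\epsilon)\|\mathbf H\|_F^2\le\|\mathbf H\mathbb b\|^2\le(1+\epsilon)\|\mathbf H\|_F^2$ for all $\mathbf H\in\mathcal H$. R-RIP over $\mathcal H-\mathcal H$ with parameter $\delta$ and precision $\mu$: $(1-\delta)\|\mathbf H-\mathbf H'\|_F^2\le\|(\mathbf H-\mathbf H')\mathbb b\|^2\le(1+\delta)\|\mathbf H-\mathbf H'\|_F^2$ for all $\mathbf H,\mathbf H'\in\mathcal H$ with $\|\mathbf H-\mathbf H'\|_F\ge\mu\max\{\|\mathbf H\|_F,\|\mathbf H'\|_F\}$. *)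

theory Defs
  imports Complex_Main "Jordan_Normal_Form.Matrix"
begin

text \<open>Matrices and vectors are indexed from 0.\<close>

definition euclidean_norm :: "real vec \<Rightarrow> real" where
  "euclidean_norm v = sqrt (v \<bullet> v)"

definition frobenius_norm :: "real mat \<Rightarrow> real" where
  "frobenius_norm A = sqrt (\<Sum>i<dim_row A. \<Sum>j<dim_col A. (A $$ (i, j))\<^sup>2)"

definition kronecker :: "real mat \<Rightarrow> real mat \<Rightarrow> real mat" (infixl "\<otimes>\<^sub>K" 70) where
  "A \<otimes>\<^sub>K B = mat (dim_row A * dim_row B) (dim_col A * dim_col B)
     (\<lambda>(i, j). A $$ (i div dim_row B, j div dim_col B) * B $$ (i mod dim_row B, j mod dim_col B))"

definition vectorize :: "real mat \<Rightarrow> real vec" where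
  "vectorize B = vec (dim_row B * dim_col B) (\<lambda>j. B $$ (j mod dim_row B, j div dim_row B))"

definition ordered_selections :: "nat \<Rightarrow> nat \<Rightarrow> real mat set" where
  "ordered_selections m n =
     {mat m n (\<lambda>(l, p). if p = \<iota> l then 1 else 0) | \<iota> :: nat \<Rightarrow> nat.
        strict_mono_on {..<m} \<iota> \<and> \<iota> ` {..<m} \<subseteq> {..<n}}"

definition kron_selections :: "nat \<Rightarrow> nat \<Rightarrow> nat \<Rightarrow> real mat set" where
  "kron_selections k m n =
     {mat_of_row y \<otimes>\<^sub>K S | y S. y \<in> carrier_vec k \<and> S \<in> ordered_selections m n}"

definition rip :: "real mat set \<Rightarrow> real \<Rightarrow> real mat \<Rightarrow> bool" where
  "rip \<H> \<epsilon> B \<longleftrightarrow>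
     (\<forall>H\<in>\<H>. (1 - \<epsilon>) * (frobenius_norm H)\<^sup>2 \<le> (euclidean_norm (H *\<^sub>v vectorize B))\<^sup>2 \<and>
              (euclidean_norm (H *\<^sub>v vectorize B))\<^sup>2 \<le> (1 + \<epsilon>) * (frobenius_norm H)\<^sup>2)"

text \<open>The restricted property over \<open>\<H> - \<H>\<close> is phrased in terms of \<open>\<H>\<close>, because the
  precision condition refers to the two matrices and not only to their difference.\<close>

definition r_rip :: "real mat set \<Rightarrow> real \<Rightarrow> real \<Rightarrow> real mat \<Rightarrow> bool" where
  "r_rip \<H> \<delta> \<mu> B \<longleftrightarrow>
     (\<forall>H\<in>\<H>. \<forall>H'\<in>\<H>.
        frobenius_norm (H - H') \<ge> \<mu> * max (frobenius_norm H) (frobenius_norm H') \<longrightarrow>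
        (1 - \<delta>) * (frobenius_norm (H - H'))\<^sup>2 \<le> (euclidean_norm ((H - H') *\<^sub>v vectorize B))\<^sup>2 \<and>
        (euclidean_norm ((H - H') *\<^sub>v vectorize B))\<^sup>2 \<le> (1 + \<delta>) * (frobenius_norm (H - H'))\<^sup>2)"

text \<open>The column-stacking convention of \<open>vectorize\<close> matches the Kronecker product:
  the matrix \<open>mat_of_row y \<otimes>\<^sub>K S\<close> maps \<open>vectorize B\<close> to \<open>S B y\<close>.\<close>

lemma kronecker_row_mult_vectorize:
  assumes y: "y \<in> carrier_vec k" and S: "S \<in> carrier_mat m n" and B: "B \<in> carrier_mat n k"
  shows "(mat_of_row y \<otimes>\<^sub>K S) *\<^sub>v vectorize B = S *\<^sub>v (B *\<^sub>v y)"
proof (rule eq_vecI)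
  show "dim_vec ((mat_of_row y \<otimes>\<^sub>K S) *\<^sub>v vectorize B) = dim_vec (S *\<^sub>v (B *\<^sub>v y))"
    using S by (simp add: kronecker_def)
next
  fix i assume "i < dim_vec (S *\<^sub>v (B *\<^sub>v y))"
  then have i: "i < m" using S by simp
  let ?f = "\<lambda>j. y $ (j div n) * S $$ (i, j mod n) * B $$ (j mod n, j div n)"
  have ix: "j div n < k" "j mod n < n" if "j < k * n" for j
    using that by (auto simp: less_mult_imp_div_less intro!: mod_less_divisor gr0I)
  have "((mat_of_row y \<otimes>\<^sub>K S) *\<^sub>v vectorize B) $ i = (\<Sum>j = 0..<k * n. ?f j)"
    using i y S B ix
    by (auto simp: kronecker_def vectorize_def scalar_prod_def mult.commute[of n k] intro!: sum.cong)
  also have "\<dots> = (\<Sum>q<k. \<Sum>j = q * n..<q * n + n. ?f j)"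
    using sum.nat_group[of ?f n k] by (simp add: lessThan_atLeast0)
  also have "\<dots> = (\<Sum>q<k. \<Sum>p = 0..<n. S $$ (i, p) * (B $$ (p, q) * y $ q))"
  proof (rule sum.cong[OF refl])
    fix q
    have "(\<Sum>j = q * n..<q * n + n. ?f j) = (\<Sum>p = 0..<n. ?f (p + q * n))"
      using sum.shift_bounds_nat_ivl[of ?f 0 "q * n" n] by (simp add: add.commute)
    also have "\<dots> = (\<Sum>p = 0..<n. S $$ (i, p) * (B $$ (p, q) * y $ q))"
      by (rule sum.cong) auto
    finally show "(\<Sum>j = q * n..<q * n + n. ?f j) = (\<Sum>p = 0..<n. S $$ (i, p) * (B $$ (p, q) * y $ q))" .
  qed
  also have "\<dots> = (\<Sum>p = 0..<n. S $$ (i, p) * (\<Sum>q = 0..<k. B $$ (p, q) * y $ q))"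
    unfolding sum_distrib_left lessThan_atLeast0 by (rule sum.swap)
  also have "\<dots> = (S *\<^sub>v (B *\<^sub>v y)) $ i"
    using i y S B by (auto simp: scalar_prod_def intro!: sum.cong)
  finally show "((mat_of_row y \<otimes>\<^sub>K S) *\<^sub>v vectorize B) $ i = (S *\<^sub>v (B *\<^sub>v y)) $ i" .
qed

end

(* Since H0 is itself feasible, the least-squares residual of Hhat is at most |w|, so that
   |(Hhat - H0) b| <= 2 |w| = 2 |H0 b| / sqrt snr.  If Hhat and H0 are far apart in the sense of
   the precision \<mu>, the R-RIP turns this into a bound on |Hhat - H0| (with
   (1 + \<delta>) (1 - 2 \<delta>) <= 1 - \<delta>); if they are close, the precision bounds |Hhat - H0| by
   \<mu> max |H0| |Hhat|, and the RIP bounds |Hhat| in terms of |H0|. *)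

theory Submission
  imports Defs "HOL-Analysis.L2_Norm"
begin

text \<open>Makes Minkowski's inequality and the criterion for a vanishing norm available for
  \<open>euclidean_norm\<close>.\<close>

lemma euclidean_norm_eq_L2_set: "euclidean_norm v = L2_set (($) v) {0..<dim_vec v}"
  by (simp add: euclidean_norm_def L2_set_def scalar_prod_def power2_eq_square)

lemma euclidean_norm_nonneg [simp]: "0 \<le> euclidean_norm v"
  by (simp add: euclidean_norm_eq_L2_set)

lemma frobenius_norm_nonneg [simp]: "0 \<le> frobenius_norm A"
  by (simp add: frobenius_norm_def sum_nonneg)

lemma euclidean_norm_triangle:
  assumes "u \<in> carrier_vec n" and "v \<in> carrier_vec n"
  shows "euclidean_norm (u + v) \<le> euclidean_norm u + euclidean_norm v"
proof -
  have "euclidean_norm (u + v) = L2_set (\<lambda>i. u $ i + v $ i) {0..<n}"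
    using assms by (auto simp: euclidean_norm_eq_L2_set intro!: L2_set_cong)
  also have "\<dots> \<le> euclidean_norm u + euclidean_norm v"
    using L2_set_triangle_ineq[of "($) u" "($) v" "{0..<n}"] assms
    by (simp add: euclidean_norm_eq_L2_set)
  finally show ?thesis .
qed

lemma euclidean_norm_le_diff_add:
  assumes "u \<in> carrier_vec n" and "v \<in> carrier_vec n"
  shows "euclidean_norm u \<le> euclidean_norm (u - v) + euclidean_norm v"
proof -
  have "u = (u - v) + v"
    using assms by auto
  with euclidean_norm_triangle[of "u - v" n v] assms show ?thesis
    by simp
qed

lemma euclidean_norm_uminus: "euclidean_norm (- v) = euclidean_norm v"
  by (simp add: euclidean_norm_def scalar_prod_def)

lemma euclidean_norm_pos:
  assumes "v \<in> carrier_vec n" and "v \<noteq> 0\<^sub>v n"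
  shows "0 < euclidean_norm v"
proof -
  obtain i where "i < n" "v $ i \<noteq> 0"
    using assms by (metis carrier_vecD eq_vecI index_zero_vec)
  then have "euclidean_norm v \<noteq> 0"
    using assms by (auto simp: euclidean_norm_eq_L2_set L2_set_eq_0_iff)
  then show ?thesis
    using euclidean_norm_nonneg[of v] by linarith
qed

text \<open>A sum of squares dominates each summand. Hence a single nonzero entry already forces a
  positive Frobenius norm.\<close>

lemma abs_entry_le_frobenius_norm:
  assumes "i < dim_row A" and "j < dim_col A"
  shows "\<bar>A $$ (i, j)\<bar> \<le> frobenius_norm A"
proof -
  have "(A $$ (i, j))\<^sup>2 \<le> (\<Sum>j<dim_col A. (A $$ (i, j))\<^sup>2)"
    by (rule member_le_sum) (use assms in auto)
  also have "\<dots> \<le> (\<Sum>i<dim_row A. \<Sum>j<dim_col A. (A $$ (i, j))\<^sup>2)"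
    by (rule member_le_sum[where f = "\<lambda>i. \<Sum>j<dim_col A. (A $$ (i, j))\<^sup>2"])
      (use assms in \<open>auto intro: sum_nonneg\<close>)
  finally show ?thesis
    by (simp add: frobenius_norm_def real_le_rsqrt)
qed

lemma ordered_selections_carrier: "S \<in> ordered_selections m n \<Longrightarrow> S \<in> carrier_mat m n"
  by (auto simp: ordered_selections_def)

lemma kron_selections_carrier: "H \<in> kron_selections k m n \<Longrightarrow> H \<in> carrier_mat m (k * n)"
  by (auto simp: kron_selections_def kronecker_def dest!: ordered_selections_carrier)

text \<open>Row 0 of \<open>S\<close> exists and has its 1 in some column \<open>p\<close>, and
  \<open>y\<close> has a nonzero coordinate \<open>q\<close>. Column \<open>q * n + p\<close> has
  quotient \<open>q\<close> and remainder \<open>p\<close> modulo \<open>n\<close>, so the Kronecker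
  product carries \<open>y $ q\<close> there in row 0.\<close>

lemma frobenius_norm_kron_selection_pos:
  assumes "0 < m" and y: "y \<in> carrier_vec k" "y \<noteq> 0\<^sub>v k" and S: "S \<in> ordered_selections m n"
  shows "0 < frobenius_norm (mat_of_row y \<otimes>\<^sub>K S)"
proof -
  obtain q where q: "q < k" "y $ q \<noteq> 0"
    using y by (metis carrier_vecD eq_vecI index_zero_vec)
  obtain p where p: "p < n" "S $$ (0, p) = 1"
    using S \<open>0 < m\<close> by (fastforce simp: ordered_selections_def)
  have Sc: "S \<in> carrier_mat m n"
    using S by (rule ordered_selections_carrier)
  have "q * n + p < Suc q * n"
    using p by simp
  also have "\<dots> \<le> k * n"
    using q by (intro mult_le_mono) auto
  finally have "q * n + p < k * n" .
  then have "\<bar>y $ q\<bar> \<le> frobenius_norm (mat_of_row y \<otimes>\<^sub>K S)"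
    using abs_entry_le_frobenius_norm[of 0 "mat_of_row y \<otimes>\<^sub>K S" "q * n + p"] y(1) Sc p q \<open>0 < m\<close>
    by (simp add: kronecker_def)
  with q show ?thesis by linarith
qed

text \<open>Passing through the observation \<open>v + w\<close> costs the norm of \<open>w\<close>
  twice: once as the distance from \<open>v\<close>, once as the upper bound on the residual of
  \<open>u\<close>.\<close>

lemma least_squares_deviation:
  assumes u: "u \<in> carrier_vec m" and v: "v \<in> carrier_vec m" and w: "w \<in> carrier_vec m"
    and "euclidean_norm (u - (v + w)) \<le> euclidean_norm (v - (v + w))"
  shows "euclidean_norm (u - v) \<le> 2 * euclidean_norm w"
proof -
  have "v - (v + w) = - w" "u - v = (u - (v + w)) + w"
    using u v w by auto
  with assms euclidean_norm_triangle[of "u - (v + w)" m w] show ?thesis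
    by (simp add: euclidean_norm_uminus)
qed

text \<open>The chain shared by both cases of the theorem: \<open>p\<close> is a lower and
  \<open>q\<close> an upper isometry constant, and \<open>t\<close> compares the two images. There
  \<open>a\<close> and \<open>g\<close> are the norms of \<open>H0\<close> and of its image;
  \<open>c\<close> and \<open>f\<close> are those of \<open>Hhat - H0\<close> in the far case and of
  \<open>Hhat\<close> in the close case.\<close>

lemma le_sqrt_quotient_mult:
  fixes a c p q t :: real
  assumes "0 < p" and "0 \<le> q" and "0 \<le> a" and "0 \<le> c" and "0 \<le> t"
    and "p * c\<^sup>2 \<le> f\<^sup>2" and "f \<le> t * g" and "g\<^sup>2 \<le> q * a\<^sup>2" and "0 \<le> f" and "0 \<le> g"
  shows "c \<le> sqrt q / sqrt p * t * a"
proof -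
  have "sqrt p * c \<le> f"
    by (rule power2_le_imp_le) (use assms in \<open>simp_all add: power_mult_distrib\<close>)
  also have "f \<le> t * g" by fact
  also have "g \<le> sqrt q * a"
    by (rule power2_le_imp_le) (use assms in \<open>simp_all add: power_mult_distrib\<close>)
  finally have "sqrt p * c \<le> t * (sqrt q * a)"
    using \<open>0 \<le> t\<close> by (simp add: mult_left_mono)
  then show ?thesis
    using \<open>0 < p\<close> by (simp add: field_simps)
qed

theorem theorem1:
  fixes k m n :: nat and B S0 H0 Hhat :: "real mat" and y0 w x :: "real vec"
    and \<epsilon> \<delta> \<mu> snr \<chi> :: real
  assumes "0 < k" and "0 < m" and "0 < n" and "m \<le> n"
    and "B \<in> carrier_mat n k"
    and "0 < \<epsilon>" and "\<epsilon> < 1" and "0 < \<delta>" and "\<delta> < 1 / 2" and "0 < \<mu>" and "\<epsilon> \<le> \<delta>"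
    and "rip (kron_selections k m n) \<epsilon> B"
    and "r_rip (kron_selections k m n) \<delta> \<mu> B"
    and "y0 \<in> carrier_vec k" and "y0 \<noteq> 0\<^sub>v k" and "S0 \<in> ordered_selections m n"
    and "H0 = mat_of_row y0 \<otimes>\<^sub>K S0"
    and "w \<in> carrier_vec m" and "w \<noteq> 0\<^sub>v m"
    and "x = H0 *\<^sub>v vectorize B + w"
    and "snr = (euclidean_norm (H0 *\<^sub>v vectorize B))\<^sup>2 / (euclidean_norm w)\<^sup>2"
    and "is_arg_min (\<lambda>H. euclidean_norm (H *\<^sub>v vectorize B - x))
           (\<lambda>H. H \<in> kron_selections k m n) Hhat"
    and "\<chi> = max (\<mu> * (sqrt (1 + \<epsilon>) / sqrt (1 - \<epsilon>)) * (1 + 2 / sqrt snr))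
                 (2 / sqrt (snr * (1 - 2 * \<delta>)))"
  shows "frobenius_norm (Hhat - H0) \<le> \<chi> * frobenius_norm H0"
proof -
  let ?\<H> = "kron_selections k m n"
  let ?b = "vectorize B"
  let ?u = "Hhat *\<^sub>v ?b" and ?v = "H0 *\<^sub>v ?b"
  let ?W = "euclidean_norm w" and ?F = "euclidean_norm ?v"
  let ?a = "frobenius_norm H0" and ?c = "frobenius_norm Hhat" and ?d = "frobenius_norm (Hhat - H0)"
  have H0: "H0 \<in> ?\<H>"
    using assms(14,16,17) by (auto simp: kron_selections_def)
  have Hhat: "Hhat \<in> ?\<H>"
    using assms(22) by (simp add: is_arg_min_def)
  have min: "euclidean_norm (?u - x) \<le> euclidean_norm (?v - x)"
    using assms(22) H0 by (meson is_arg_min_def not_le)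
  have b: "?b \<in> carrier_vec (k * n)"
    using carrier_matD[OF assms(5)] by (intro carrier_vecI) (simp add: vectorize_def)
  have H0c: "H0 \<in> carrier_mat m (k * n)" and Hhatc: "Hhat \<in> carrier_mat m (k * n)"
    using H0 Hhat by (simp_all add: kron_selections_carrier)
  have uv: "?u \<in> carrier_vec m" "?v \<in> carrier_vec m"
    using mult_mat_vec_carrier H0c Hhatc b by blast+
  have diff: "(Hhat - H0) *\<^sub>v ?b = ?u - ?v"
    using minus_mult_distrib_mat_vec[OF Hhatc H0c b] .
  have dev: "euclidean_norm (?u - ?v) \<le> 2 * ?W"
    using least_squares_deviation[OF uv assms(18)] min assms(20) by simp
  have a: "0 < ?a"
    unfolding assms(17) using frobenius_norm_kron_selection_pos assms(2,14,15,16) by blast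
  have W: "0 < ?W"
    using euclidean_norm_pos assms(18,19) by blast
  have ripH: "(1 - \<epsilon>) * (frobenius_norm H)\<^sup>2 \<le> (euclidean_norm (H *\<^sub>v ?b))\<^sup>2"
    "(euclidean_norm (H *\<^sub>v ?b))\<^sup>2 \<le> (1 + \<epsilon>) * (frobenius_norm H)\<^sup>2" if "H \<in> ?\<H>" for H
    using assms(12) that by (auto simp: rip_def)
  \<comment> \<open>The lower RIP bound keeps the signal away from zero. So \<open>snr\<close> is
    positive, and dividing by \<open>sqrt snr\<close> is a genuine division rather than the default
    value 0.\<close>
  have "0 < (1 - \<epsilon>) * ?a\<^sup>2"
    using a assms(7) by simp
  also have "\<dots> \<le> ?F\<^sup>2"
    using ripH(1)[OF H0] .
  finally have F: "0 < ?F"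
    by (simp add: less_le)
  have s: "sqrt snr = ?F / ?W"
    using F W by (simp add: assms(21) real_sqrt_divide)
  have s0: "0 < sqrt snr"
    using s F W by simp
  \<comment> \<open>Expresses the deviation bound in units of the signal, which makes
    \<open>2 / sqrt snr\<close> the factor \<open>t\<close> of the far case.\<close>
  have W_eq: "2 * ?W = 2 / sqrt snr * ?F"
    using F W by (simp add: s)
  show ?thesis
  proof (cases "\<mu> * max ?c ?a \<le> ?d")
    case True
    have "(1 - \<delta>) * ?d\<^sup>2 \<le> (euclidean_norm (?u - ?v))\<^sup>2"
      using assms(13) Hhat H0 True diff unfolding r_rip_def by metis
    then have "?d \<le> sqrt (1 + \<delta>) / sqrt (1 - \<delta>) * (2 / sqrt snr) * ?a"
    proof (rule le_sqrt_quotient_mult[rotated 5])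
      show "euclidean_norm (?u - ?v) \<le> 2 / sqrt snr * ?F"
        using dev W_eq by simp
      have "?F\<^sup>2 \<le> (1 + \<epsilon>) * ?a\<^sup>2"
        using ripH(2)[OF H0] .
      \<comment> \<open>The signal is bounded by the RIP; relaxing \<epsilon> to \<delta> leaves a
        quotient in \<delta> alone.\<close>
      also have "\<dots> \<le> (1 + \<delta>) * ?a\<^sup>2"
        using assms(11) by (simp add: mult_right_mono)
      finally show "?F\<^sup>2 \<le> (1 + \<delta>) * ?a\<^sup>2" .
    qed (use assms(8,9) s0 in auto)
    also have "\<dots> \<le> 2 / sqrt (snr * (1 - 2 * \<delta>)) * ?a"
    proof -
      \<comment> \<open>The two sides differ by exactly 2 \<delta> squared. Since \<delta> < 1/2,
        both denominators below are positive.\<close>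
      have "(1 + \<delta>) * (1 - 2 * \<delta>) \<le> 1 - \<delta>"
        using assms(8) by (simp add: algebra_simps)
      then have "(1 + \<delta>) / (1 - \<delta>) \<le> 1 / (1 - 2 * \<delta>)"
        using assms(9) by (simp add: field_simps)
      then have "sqrt (1 + \<delta>) / sqrt (1 - \<delta>) \<le> 1 / sqrt (1 - 2 * \<delta>)"
        by (metis real_sqrt_divide real_sqrt_le_mono real_sqrt_one)
      then have "sqrt (1 + \<delta>) / sqrt (1 - \<delta>) * (2 / sqrt snr * ?a)
          \<le> 1 / sqrt (1 - 2 * \<delta>) * (2 / sqrt snr * ?a)"
        by (rule mult_right_mono) (use s0 a in simp)
      then show ?thesis
        by (simp add: real_sqrt_mult mult_ac)
    qed
    also have "\<dots> \<le> \<chi> * ?a"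
      unfolding assms(23) by (rule mult_right_mono) simp_all
    finally show ?thesis .
  next
    case False
    let ?t = "1 + 2 / sqrt snr"
    have "euclidean_norm ?u \<le> euclidean_norm (?u - ?v) + ?F"
      using euclidean_norm_le_diff_add[OF uv] .
    \<comment> \<open>The estimate has image at most that of \<open>H0\<close> plus the deviation,
      whence the summand 1 in \<open>?t\<close>.\<close>
    then have u_le: "euclidean_norm ?u \<le> ?t * ?F"
      using dev W_eq unfolding distrib_right by linarith
    have t: "1 \<le> ?t"
      using s0 by simp
    have "?c \<le> sqrt (1 + \<epsilon>) / sqrt (1 - \<epsilon>) * ?t * ?a"
      using assms(6,7) t
      by (intro le_sqrt_quotient_mult[OF _ _ _ _ _ ripH(1)[OF Hhat] u_le ripH(2)[OF H0]]) auto
    \<comment> \<open>The precision condition involves the maximum of both norms, so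
      \<open>H0\<close> has to obey the bound just shown for \<open>Hhat\<close>. It does because
      the factor is a product of two numbers that are at least 1.\<close>
    moreover have "?a \<le> sqrt (1 + \<epsilon>) / sqrt (1 - \<epsilon>) * ?t * ?a"
    proof -
      have "1 \<le> sqrt (1 + \<epsilon>) / sqrt (1 - \<epsilon>)"
        using assms(6,7) by simp
      with t have "1 * 1 \<le> sqrt (1 + \<epsilon>) / sqrt (1 - \<epsilon>) * ?t"
        by (intro mult_mono) auto
      from mult_right_mono[OF this, of ?a] show ?thesis
        using a by simp
    qed
    ultimately have "max ?c ?a \<le> sqrt (1 + \<epsilon>) / sqrt (1 - \<epsilon>) * ?t * ?a"
      by simp
    then have "\<mu> * max ?c ?a \<le> \<mu> * (sqrt (1 + \<epsilon>) / sqrt (1 - \<epsilon>) * ?t * ?a)"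
      using assms(10) by (intro mult_left_mono) auto
    also have "\<dots> = \<mu> * (sqrt (1 + \<epsilon>) / sqrt (1 - \<epsilon>)) * ?t * ?a"
      by (simp only: mult.assoc)
    also have "\<dots> \<le> \<chi> * ?a"
      unfolding assms(23) by (rule mult_right_mono) simp_all
    finally show ?thesis
      using False by linarith
  qed
qed

end
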